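(* Let $1\le p<\infty$ and $1<\rho\le r<\infty$ be fixed. (i) It is not true that the estimate \[ \sup_{\lambda>0}\big\|\lambda N_\lambda(f(\cdot,t):t\in\mathbb{N})^{1/r}\big\|_{\ell^{p,\infty}(\mathbb{Z})}\le C_{p,\rho,r}\sup_{I\in\mathfrak{S}_\infty(\mathbb{N})}\big\|O^\rho_{I,\infty}(f(\cdot,t):t\in\mathbb{N})\big\|_{\ell^p(\mathbb{Z})} \] holds uniformly for every measurable function $f\colon\mathbb{Z}\times\mathbb{N}\to\mathbb{R}$; that is, there is no finite constant $C_{p,\rho,r}$, independent of $f$, for which this inequality holds for all $f\colon\mathbb{Z}\times\mathbb{N}\to\mathbb{R}$. (ii) Consequently, the estimate \[ \big\|V^r(f(\cdot,t):t\in\mathbb{N})\big\|_{\ell^{p,\infty}(\mathbb{Z})}\le C_{p,\rho,r}\sup_{I\in\mathfrak{S}_\infty(\mathbb{N})}\big\|O^\rho_{I,\infty}(f(\cdot,t):t\in\mathbb{N})\big\|_{\ell^p(\mathbb{Z})} \] cannot hold uniformly for all measurable functions $f\colon\mathbb{Z}\times\mathbb{N}\to\mathbb{R}$ (in the same sense).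
   Context: $\mathbb{N}=\{0,1,2,\dots\}$. $\mathbb{Z}$ carries the counting measure. For a measure space $(X,\mu)$ and $p\in[1,\infty)$, $\|g\|_{L^{p,\infty}(X)}:=\sup_{\lambda>0}\lambda\,\mu(\{x\in X:|g(x)|>\lambda\})^{1/p}$; for counting measure write $\ell^{p}$, $\ell^{p,\infty}$. $\mathfrak{S}_\infty(\mathbb{N})$ is the set of all strictly increasing infinite sequences $I=(I_0<I_1<I_2<\dots)$ with values in $\mathbb{N}$. All quantities below are computed in the variable $t\in\mathbb{N}$ for each fixed first variable, and may equal $+\infty$. For $(\mathfrak{a}_t:t\in\mathbb{N})\subseteq\mathbb{C}$: - $\rho$-oscillation: $O^\rho_{I,\infty}(\mathfrak{a}_t:t\in\mathbb{N}):=\Big(\sum_{j=0}^{\infty}\sup_{t\in[I_j,I_{j+1})\cap\mathbb{N}}|\mathfrak{a}_t-\mathfrak{a}_{I_j}|^\rho\Big)^{1/\rho}$. - $r$-variation: $V^r(\mathfrak{a}_t:t\in\mathbb{N}):=\sup_{J\ge1}\ \sup_{t_0<\dots<t_J,\ t_j\in\mathbb{N}}\Big(\sum_{j=0}^{J-1}|\mathfrak{a}_{t_{j+1}}-\mathfrak{a}_{t_j}|^r\Big)^{1/r}$. - $\lambda$-jump counting function, $\lambda>0$: $N_\lambda(\mathfrak{a}_t:t\in\mathbb{N})$ is the supremum of all $J\in\mathbb{N}$ for which there exist $t_0<\dots<t_J$ in $\mathbb{N}$ with $\min_{0\le j\le J-1}|\mathfrak{a}_{t_{j+1}}-\mathfrak{a}_{t_j}|\ge\lambda$.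 *)

theory Defs
  imports "HOL-Analysis.Analysis"
begin

text \<open>
  All quantities below may be infinite and are valued in \<^typ>\<open>ennreal\<close>.
  The library has no real power on \<^typ>\<open>ennreal\<close>; the extension by \<open>\<infinity>\<^sup>p = \<infinity>\<close>
  is only meant for exponents \<open>p > 0\<close>.
\<close>

definition epowr :: "ennreal \<Rightarrow> real \<Rightarrow> ennreal" where
  "epowr x p = (if x = top then top else ennreal (enn2real x powr p))"

text \<open>
  In both norms \<open>g\<close> plays the role of the modulus \<open>\<bar>g\<bar>\<close>.
\<close>

definition Lp_norm :: "real \<Rightarrow> 'a measure \<Rightarrow> ('a \<Rightarrow> ennreal) \<Rightarrow> ennreal" where
  "Lp_norm p M g = epowr (\<integral>\<^sup>+ x. epowr (g x) p \<partial>M) (1 / p)"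

definition weak_Lp_norm :: "real \<Rightarrow> 'a measure \<Rightarrow> ('a \<Rightarrow> ennreal) \<Rightarrow> ennreal" where
  "weak_Lp_norm p M g =
     (SUP l\<in>{0::real<..}. ennreal l * epowr (emeasure M {x \<in> space M. g x > ennreal l}) (1 / p))"

abbreviation lp_norm :: "real \<Rightarrow> ('a \<Rightarrow> ennreal) \<Rightarrow> ennreal" where
  "lp_norm p \<equiv> Lp_norm p (count_space UNIV)"

abbreviation weak_lp_norm :: "real \<Rightarrow> ('a \<Rightarrow> ennreal) \<Rightarrow> ennreal" where
  "weak_lp_norm p \<equiv> weak_Lp_norm p (count_space UNIV)"

definition seqs_inf :: "(nat \<Rightarrow> nat) set" where
  "seqs_inf = {I. strict_mono I}"

definition oscillation ::
  "real \<Rightarrow> (nat \<Rightarrow> nat) \<Rightarrow> (nat \<Rightarrow> 'a::real_normed_vector) \<Rightarrow> ennreal" where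
  "oscillation \<rho> I a =
     epowr (\<Sum>j. SUP t\<in>{I j..<I (Suc j)}. ennreal (norm (a t - a (I j)) powr \<rho>)) (1 / \<rho>)"

text \<open>
  A finite sequence \<open>t\<^sub>0 < \<dots> < t\<^sub>J\<close> is the restriction to \<open>{..J}\<close> of a function on \<^typ>\<open>nat\<close>.
\<close>

definition variation :: "real \<Rightarrow> (nat \<Rightarrow> 'a::real_normed_vector) \<Rightarrow> ennreal" where
  "variation r a =
     (SUP J\<in>{1..}. SUP t\<in>{t :: nat \<Rightarrow> nat. strict_mono_on {..J} t}.
        epowr (\<Sum>j<J. ennreal (norm (a (t (Suc j)) - a (t j)) powr r)) (1 / r))"

definition jump_count :: "real \<Rightarrow> (nat \<Rightarrow> 'a::real_normed_vector) \<Rightarrow> ennreal" where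
  "jump_count l a =
     (SUP J\<in>{J. \<exists>t :: nat \<Rightarrow> nat. strict_mono_on {..J} t \<and>
                   (\<forall>j<J. norm (a (t (Suc j)) - a (t j)) \<ge> l)}. of_nat J)"

end

theory Submission
  imports Defs
begin

text \<open>
  Oscillations can only be large if the sequence \<open>I\<close> resolves the scale on which \<open>f(x, \<cdot>)\<close> moves, and a
  single sequence \<open>I\<close> resolves only one scale at each place. The counterexample is therefore a family
  of slow waves at many scales. Fix the number of jumps \<open>J \<ge> 2\<close> and a number of scales \<open>S\<close>, and put
  \<open>N = J\<^sup>S\<close>. For each scale \<open>s < S\<close> cut \<open>[0, N)\<close> into windows of length \<open>J\<^sup>s\<^sup>+\<^sup>1\<close>; inside each window
  let a cosine wave run through \<open>J\<close> half-periods of length \<open>J\<^sup>s\<close>, and continue it by constants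
  outside. Each window is used with multiplicity equal to its length: the index set consists of the
  pairs \<open>(s, x)\<close> with \<open>s < S\<close> and \<open>x < N\<close>, and \<open>(s, x)\<close> carries the wave of the window of scale \<open>s\<close>
  that contains \<open>x\<close>. Every member has \<open>J\<close> jumps of a fixed size, so the left-hand sides of both
  estimates are at least a constant times \<open>J\<^sup>1\<^sup>/\<^sup>r (S N)\<^sup>1\<^sup>/\<^sup>p\<close> (\<open>jump_count_ge\<close>, \<open>variation_ge\<close>).

  Now let \<open>I\<close> be arbitrary. An interval \<open>[I\<^sub>j, I\<^sub>j\<^sub>+\<^sub>1)\<close> that spends the time \<open>m\<close> in a window of scale \<open>s\<close>
  contributes at most \<open>min(1, m / J\<^sup>s)\<^sup>\<rho>\<close> to the \<open>\<rho>\<close>-th power of the oscillation. At most two intervals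
  that are as long as the window meet it (\<open>long_steps_le\<close>). The contributions of the shorter
  intervals are summed over all members of the family. For an interval of length \<open>l\<close>, the sum over \<open>x\<close>
  is at most \<open>J l min(1, l / J\<^sup>s)\<^sup>\<rho>\<^sup>-\<^sup>1\<close>. Because \<open>\<rho> > 1\<close>, this decays geometrically as \<open>J\<^sup>s\<close> grows beyond \<open>l\<close>,
  while the scales with \<open>J\<^sup>s\<^sup>+\<^sup>1 \<le> l\<close> do not occur, the interval being long for them. So the sum over \<open>s\<close>
  is \<open>O(J l)\<close> whatever \<open>S\<close> is, and since the lengths add up to \<open>N\<close> the total is \<open>O(J N)\<close>
  (\<open>sum_short_sum_le\<close>). Divided by the \<open>S N\<close> members this average tends to \<open>0\<close> as \<open>S\<close> grows. Hence for
  \<open>S\<close> large in terms of \<open>J\<close> the average of the \<open>p\<close>-th power of the oscillation is bounded by a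
  constant independent of \<open>J\<close> and \<open>I\<close> (\<open>ex_many_jumps_small_oscillation\<close>), and \<open>J \<rightarrow> \<infinity>\<close> refutes both
  estimates.
\<close>

section \<open>Extended powers and sequence norms\<close>

lemma epowr_mono: "x \<le> y \<Longrightarrow> 0 \<le> p \<Longrightarrow> epowr x p \<le> epowr y p"
  unfolding epowr_def
  by (auto simp: top_unique less_top intro!: ennreal_leI powr_mono2 enn2real_mono)

lemma epowr_ennreal: "0 \<le> x \<Longrightarrow> epowr (ennreal x) p = ennreal (x powr p)"
  unfolding epowr_def by simp

text \<open>
  The weak norm is defined by strict superlevel sets; testing it at \<open>v / 2\<close> costs only a harmless
  factor \<open>2\<close>.
\<close>

lemma weak_lp_norm_ge:
  fixes h :: "'a \<Rightarrow> ennreal"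
  assumes "finite A" "0 < p" "0 < v" "\<And>x. x \<in> A \<Longrightarrow> ennreal v \<le> h x"
  shows "ennreal (v / 2 * real (card A) powr (1 / p)) \<le> weak_lp_norm p h"
proof -
  have sub: "A \<subseteq> {x \<in> space (count_space UNIV). h x > ennreal (v / 2)}"
  proof
    fix x assume "x \<in> A"
    have "ennreal (v / 2) < ennreal v" using assms(3) by (simp add: ennreal_lessI)
    also have "\<dots> \<le> h x" using assms(4) \<open>x \<in> A\<close> .
    finally show "x \<in> {x \<in> space (count_space UNIV). h x > ennreal (v / 2)}" by simp
  qed
  have "ennreal (real (card A)) = emeasure (count_space UNIV) A"
    using assms(1) by (simp add: emeasure_count_space ennreal_of_nat_eq_real_of_nat)
  also have "\<dots> \<le> emeasure (count_space UNIV) {x \<in> space (count_space UNIV). h x > ennreal (v / 2)}"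
    by (rule emeasure_mono[OF sub]) simp
  finally have "ennreal (v / 2) * epowr (ennreal (real (card A))) (1 / p)
     \<le> ennreal (v / 2) * epowr (emeasure (count_space UNIV) {x \<in> space (count_space UNIV). h x > ennreal (v / 2)}) (1 / p)"
    by (intro mult_left_mono epowr_mono) (use assms(2) in auto)
  also have "\<dots> \<le> weak_lp_norm p h"
    unfolding weak_Lp_norm_def by (rule SUP_upper) (use assms(3) in auto)
  finally show ?thesis
    using assms(3) by (simp only: epowr_ennreal ennreal_mult' of_nat_0_le_iff powr_ge_zero)
qed

lemma lp_norm_le:
  fixes h :: "'a \<Rightarrow> ennreal"
  assumes "finite A" "0 < p" "\<And>x. x \<notin> A \<Longrightarrow> h x = 0"
    and "\<And>x. x \<in> A \<Longrightarrow> h x \<le> ennreal (y x)" "\<And>x. x \<in> A \<Longrightarrow> 0 \<le> y x"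
  shows "lp_norm p h \<le> ennreal ((\<Sum>x\<in>A. y x powr p) powr (1 / p))"
proof -
  have "(\<integral>\<^sup>+ x. epowr (h x) p \<partial>count_space UNIV) = (\<Sum>x\<in>A. epowr (h x) p)"
    by (rule nn_integral_count_space'[OF assms(1)])
      (use assms(2,3) in \<open>auto simp: epowr_def\<close>)
  also have "\<dots> \<le> (\<Sum>x\<in>A. ennreal (y x powr p))"
    using assms(2,4,5) by (intro sum_mono) (metis epowr_ennreal epowr_mono less_imp_le)
  also have "\<dots> = ennreal (\<Sum>x\<in>A. y x powr p)" by (rule sum_ennreal) simp
  finally have "lp_norm p h \<le> epowr (ennreal (\<Sum>x\<in>A. y x powr p)) (1 / p)"
    unfolding Lp_norm_def using assms(2) by (intro epowr_mono) auto
  then show ?thesis by (simp add: epowr_ennreal sum_nonneg)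
qed

section \<open>Jumps force variation\<close>

lemma variation_ge:
  fixes a :: "nat \<Rightarrow> 'a::real_normed_vector"
  assumes "strict_mono_on {..J} t" "\<And>j. j < J \<Longrightarrow> l \<le> norm (a (t (Suc j)) - a (t j))"
    and "1 \<le> J" "0 < r" "0 < l"
  shows "ennreal (l * real J powr (1 / r)) \<le> variation r a"
proof -
  have "ennreal (real J * l powr r) = (\<Sum>j<J. ennreal (l powr r))"
    by (simp add: ennreal_of_nat_eq_real_of_nat ennreal_mult)
  also have "\<dots> \<le> (\<Sum>j<J. ennreal (norm (a (t (Suc j)) - a (t j)) powr r))"
    by (intro sum_mono ennreal_leI powr_mono2) (use assms in auto)
  finally have "epowr (ennreal (real J * l powr r)) (1 / r)
      \<le> epowr (\<Sum>j<J. ennreal (norm (a (t (Suc j)) - a (t j)) powr r)) (1 / r)"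
    using assms(4) by (intro epowr_mono) auto
  also have "\<dots> \<le> variation r a"
    unfolding variation_def using assms(1,3)
    by (intro SUP_upper2[of J] SUP_upper2[of t]) auto
  finally show ?thesis
    using assms(4,5) by (simp add: epowr_ennreal powr_mult powr_powr mult.commute)
qed

lemma jump_count_ge:
  fixes a :: "nat \<Rightarrow> 'a::real_normed_vector"
  assumes "strict_mono_on {..J} t" "\<And>j. j < J \<Longrightarrow> l \<le> norm (a (t (Suc j)) - a (t j))"
    and "0 < r" "0 < l"
  shows "ennreal (l * real J powr (1 / r)) \<le> ennreal l * epowr (jump_count l a) (1 / r)"
proof -
  have "ennreal (real J) \<le> jump_count l a"
    unfolding jump_count_def using assms(1,2)
    by (intro SUP_upper2[of J]) (auto simp: ennreal_of_nat_eq_real_of_nat)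
  then have "epowr (ennreal (real J)) (1 / r) \<le> epowr (jump_count l a) (1 / r)"
    using assms(3) by (intro epowr_mono) auto
  then show ?thesis
    using assms(4) by (simp add: epowr_ennreal ennreal_mult mult_left_mono)
qed

section \<open>A slow wave in a window\<close>

text \<open>
  For \<open>a \<le> b\<close> this is the time spent in \<open>[a, b]\<close> up to \<open>t\<close>. Written as a
  difference of minima, it telescopes over adjacent windows as well as over consecutive times.
\<close>

definition clip :: "real \<Rightarrow> real \<Rightarrow> real \<Rightarrow> real" where
  "clip a b t = min t b - min t a"

text \<open>
  The factor \<open>1 / pi\<close> normalises the wave so that, as a function of \<open>clip a b t / L\<close>, it is
  1-Lipschitz with oscillation below \<open>1\<close>; half-periods have length \<open>L\<close>.
\<close>

definition wave :: "real \<Rightarrow> real \<Rightarrow> real \<Rightarrow> nat \<Rightarrow> real" where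
  "wave L a b t = cos (pi * (clip a b (real t) / L)) / pi"

lemma clip_mono: "a \<le> b \<Longrightarrow> s \<le> t \<Longrightarrow> clip a b s \<le> clip a b t"
  unfolding clip_def by auto

lemma clip_diff_le: "a \<le> b \<Longrightarrow> s \<le> t \<Longrightarrow> clip a b t - clip a b s \<le> t - s"
  unfolding clip_def by auto

lemma abs_cos_diff_le: "\<bar>cos x - cos y\<bar> \<le> \<bar>x - y :: real\<bar>"
proof -
  have "\<bar>cos x - cos y\<bar> = 2 * (\<bar>sin ((x + y) / 2)\<bar> * \<bar>sin ((y - x) / 2)\<bar>)"
    by (simp add: cos_diff_cos abs_mult)
  also have "\<dots> \<le> 2 * (1 * \<bar>(y - x) / 2\<bar>)"
    by (intro mult_left_mono mult_mono abs_sin_x_le_abs_x) auto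
  finally show ?thesis by (simp add: abs_minus_commute)
qed

lemma wave_diff_le:
  assumes "0 < L"
  shows "\<bar>wave L a b s - wave L a b t\<bar> \<le> min 1 (\<bar>clip a b (real s) - clip a b (real t)\<bar> / L)"
proof -
  let ?x = "clip a b (real s) / L" and ?y = "clip a b (real t) / L"
  have eq: "\<bar>wave L a b s - wave L a b t\<bar> = \<bar>cos (pi * ?x) - cos (pi * ?y)\<bar> / pi"
    unfolding wave_def by (simp flip: diff_divide_distrib)
  have "\<bar>cos (pi * ?x) - cos (pi * ?y)\<bar> \<le> pi * \<bar>?x - ?y\<bar>"
    using abs_cos_diff_le[of "pi * ?x" "pi * ?y"]
    by (metis abs_mult abs_of_pos pi_gt_zero right_diff_distrib)
  moreover have "\<bar>cos (pi * ?x) - cos (pi * ?y)\<bar> \<le> pi"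
    using abs_cos_le_one[of "pi * ?x"] abs_cos_le_one[of "pi * ?y"] pi_gt3 by linarith
  ultimately have "\<bar>cos (pi * ?x) - cos (pi * ?y)\<bar> / pi \<le> min 1 \<bar>?x - ?y\<bar>"
    by (simp add: divide_le_eq mult.commute)
  also have "\<bar>?x - ?y\<bar> = \<bar>clip a b (real s) - clip a b (real t)\<bar> / L"
    using assms by (simp flip: diff_divide_distrib)
  finally show ?thesis using eq by simp
qed

lemma wave_jumps:
  fixes L a J :: nat
  assumes "0 < L"
  shows "strict_mono_on {..J} (\<lambda>i. a + i * L)"
    and "j < J \<Longrightarrow> 2 / pi \<le> \<bar>wave L a (a + J * L) (a + Suc j * L) - wave L a (a + J * L) (a + j * L)\<bar>"
proof -
  show "strict_mono_on {..J} (\<lambda>i. a + i * L)"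
    using assms by (auto simp: strict_mono_on_def)
  have val: "wave L a (a + J * L) (a + i * L) = (- 1) ^ i / pi" if "i \<le> J" for i
  proof -
    have "real i * real L \<le> real J * real L" using that by (simp add: mult_right_mono)
    then have "clip a (a + J * L) (real (a + i * L)) = real i * real L"
      unfolding clip_def using assms by auto
    then show ?thesis using assms by (simp add: wave_def mult.commute)
  qed
  show "2 / pi \<le> \<bar>wave L a (a + J * L) (a + Suc j * L) - wave L a (a + J * L) (a + j * L)\<bar>" if "j < J"
    using that val[of j] val[of "Suc j"] by (cases "even j") auto
qed

lemma oscillation_const: "oscillation \<rho> I (\<lambda>_. c) = 0"
proof -
  have "(SUP t\<in>T. 0) = (0 :: ennreal)" for T :: "nat set"
    by (intro antisym SUP_least) auto
  then show ?thesis by (simp add: oscillation_def epowr_def)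
qed

text \<open>
  The time that the interval from \<open>I j\<close> to \<open>I (Suc j)\<close> spends in \<open>[a, b]\<close>.
\<close>

definition clip_step :: "(nat \<Rightarrow> nat) \<Rightarrow> real \<Rightarrow> real \<Rightarrow> nat \<Rightarrow> real" where
  "clip_step I a b j = clip a b (real (I (Suc j))) - clip a b (real (I j))"

lemma clip_step_nonneg: "strict_mono I \<Longrightarrow> a \<le> b \<Longrightarrow> 0 \<le> clip_step I a b j"
  unfolding clip_step_def using clip_mono[of a b "real (I j)" "real (I (Suc j))"]
  by (simp add: strict_mono_less_eq)

lemma clip_step_le: "strict_mono I \<Longrightarrow> a \<le> b \<Longrightarrow> clip_step I a b j \<le> real (I (Suc j)) - real (I j)"
  unfolding clip_step_def using clip_diff_le[of a b "real (I j)" "real (I (Suc j))"]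
  by (simp add: strict_mono_less_eq)

lemma sum_clip_step_le: "0 \<le> a \<Longrightarrow> a \<le> b \<Longrightarrow> (\<Sum>j<n. clip_step I a b j) \<le> b - a"
  unfolding clip_step_def by (subst sum_lessThan_telescope) (auto simp: clip_def)

text \<open>
  Only finitely many intervals contribute: \<open>j \<le> I j\<close>, so from \<open>j = N\<close> on the wave has already
  reached its final constant value.
\<close>

lemma oscillation_wave_le:
  assumes I: "strict_mono I" and "0 < L" "a \<le> b" "b \<le> real N" "0 < \<rho>"
  shows "oscillation \<rho> I (wave L a b)
    \<le> ennreal ((\<Sum>j<N. min 1 (clip_step I a b j / L) powr \<rho>) powr (1 / \<rho>))"
proof -
  let ?c = "\<lambda>j. min 1 (clip_step I a b j / L) powr \<rho>"
  have bound: "(SUP t\<in>{I j..<I (Suc j)}. ennreal (norm (wave L a b t - wave L a b (I j)) powr \<rho>))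
      \<le> ennreal (?c j)" for j
  proof (rule SUP_least)
    fix t assume t: "t \<in> {I j..<I (Suc j)}"
    have "norm (wave L a b t - wave L a b (I j))
        \<le> min 1 (\<bar>clip a b (real t) - clip a b (real (I j))\<bar> / L)"
      using wave_diff_le[OF assms(2)] by simp
    also have "\<dots> \<le> min 1 (clip_step I a b j / L)"
    proof -
      have "\<bar>clip a b (real t) - clip a b (real (I j))\<bar> \<le> clip_step I a b j"
        unfolding clip_step_def
        using clip_mono[OF assms(3), of "real (I j)" "real t"]
          clip_mono[OF assms(3), of "real t" "real (I (Suc j))"] t by simp
      then show ?thesis using assms(2) by (intro min.mono divide_right_mono) auto
    qed
    finally show "ennreal (norm (wave L a b t - wave L a b (I j)) powr \<rho>) \<le> ennreal (?c j)"
      using assms(5) by (intro ennreal_leI powr_mono2) auto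
  qed
  \<comment> \<open>The value \<open>0 powr \<rho>\<close> is \<open>0\<close>, so steps outside the window drop out.\<close>
  have zero: "?c j = 0" if "j \<notin> {..<N}" for j
  proof -
    have "N \<le> I j" "N \<le> I (Suc j)"
      using that strict_mono_imp_increasing[OF I, of j] strict_mono_imp_increasing[OF I, of "Suc j"] by auto
    then have "clip_step I a b j = 0" using assms(3,4) by (simp add: clip_step_def clip_def)
    then show ?thesis by simp
  qed
  have "(\<Sum>j. SUP t\<in>{I j..<I (Suc j)}. ennreal (norm (wave L a b t - wave L a b (I j)) powr \<rho>))
      \<le> (\<Sum>j. ennreal (?c j))" by (intro suminf_le bound) auto
  also have "\<dots> = (\<Sum>j<N. ennreal (?c j))" by (rule suminf_finite) (use zero in auto)
  also have "\<dots> = ennreal (\<Sum>j<N. ?c j)" by (rule sum_ennreal) simp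
  finally have "oscillation \<rho> I (wave L a b) \<le> epowr (ennreal (\<Sum>j<N. ?c j)) (1 / \<rho>)"
    unfolding oscillation_def using assms(5) by (intro epowr_mono) auto
  then show ?thesis by (simp add: epowr_ennreal sum_nonneg)
qed

section \<open>Intervals that are long for a window\<close>

lemma card_le_1I:
  assumes "\<And>i j. i \<in> X \<Longrightarrow> j \<in> X \<Longrightarrow> i < j \<Longrightarrow> False"
  shows "card (X :: nat set) \<le> 1"
proof -
  have "\<forall>i\<in>X. \<forall>j\<in>X. i = j" using assms by (metis nat_neq_iff)
  then show ?thesis by (metis One_nat_def card_le_Suc0_iff_eq card.infinite zero_le)
qed

text \<open>
  An interval at least as long as the window cannot lie strictly inside it, so if it meets the
  window it covers one of the two end points, and each end point is covered once.
\<close>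

lemma long_steps_le:
  assumes I: "strict_mono I" and "0 < L" "a \<le> b" "0 \<le> \<rho>"
  shows "(\<Sum>j\<in>{j\<in>{..<N}. b - a \<le> real (I (Suc j)) - real (I j)}. min 1 (clip_step I a b j / L) powr \<rho>) \<le> 2"
proof -
  define X where "X = {j\<in>{..<N}. real (I j) \<le> a \<and> a < real (I (Suc j))}"
  define Y where "Y = {j\<in>{..<N}. real (I j) < b \<and> b \<le> real (I (Suc j))}"
  have le: "real (I (Suc i)) \<le> real (I j)" if "i < j" for i j
    using that I by (simp add: strict_mono_less_eq)
  have "card X \<le> 1" "card Y \<le> 1"
    unfolding X_def Y_def by (rule card_le_1I; use le in fastforce)+
  then have card: "card (X \<union> Y) \<le> 2" using card_Un_le[of X Y] by linarith
  have zero: "clip_step I a b j = 0"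
    if "b - a \<le> real (I (Suc j)) - real (I j)" "j \<notin> X \<union> Y" "j < N" for j
    using that assms(3) le[of j "Suc j"] I unfolding X_def Y_def clip_step_def clip_def by auto
  let ?S = "{j\<in>{..<N}. b - a \<le> real (I (Suc j)) - real (I j)}"
  have "(\<Sum>j\<in>?S. min 1 (clip_step I a b j / L) powr \<rho>)
      = (\<Sum>j\<in>?S \<inter> (X \<union> Y). min 1 (clip_step I a b j / L) powr \<rho>)"
    by (rule sum.mono_neutral_right) (use zero in auto)
  also have "\<dots> \<le> (\<Sum>j\<in>X \<union> Y. min 1 (clip_step I a b j / L) powr \<rho>)"
    by (rule sum_mono2) (auto simp: X_def Y_def)
  also have "\<dots> \<le> (\<Sum>j\<in>X \<union> Y. 1)"
    by (intro sum_mono powr_le1) (use assms clip_step_nonneg[OF I assms(3)] in auto)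
  also have "\<dots> \<le> 2" using card by simp
  finally show ?thesis .
qed


section \<open>Averaging short intervals over positions and scales\<close>

lemma sum_clip_step_windows:
  "(\<Sum>k<n. clip_step I (real (k * M)) (real (k * M) + real M) j) = clip_step I 0 (real (n * M)) j"
proof (induction n)
  case 0 show ?case by (simp add: clip_step_def clip_def)
next
  case (Suc n)
  have "real (Suc n * M) = real (n * M) + real M" by simp
  then show ?case using Suc by (simp only: sum.lessThan_Suc) (simp add: clip_step_def clip_def)
qed

lemma sum_div_windows:
  fixes h :: "nat \<Rightarrow> real"
  assumes "0 < M"
  shows "(\<Sum>x<n * M. h (x div M)) = real M * (\<Sum>k<n. h k)"
proof -
  have "(\<Sum>x<n * M. h (x div M)) = (\<Sum>k<n. \<Sum>x=k * M..<k * M + M. h (x div M))"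
    by (rule sum.nat_group[symmetric])
  also have "\<dots> = (\<Sum>k<n. \<Sum>x=k * M..<k * M + M. h k)"
  proof (intro sum.cong refl)
    fix k x assume "x \<in> {k * M..<k * M + M}"
    then have "x div M = k" by (intro div_nat_eqI) (auto simp: mult.commute)
    then show "h (x div M) = h k" by simp
  qed
  finally show ?thesis by (simp add: sum_distrib_left)
qed

text \<open>
  Split off one factor of \<open>min(1, m / L)\<^sup>\<rho>\<close>, where \<open>m\<close> is the time spent in the window: the remaining power
  \<open>\<rho> - 1\<close> is bounded through the full length of the interval, and the one linear factor \<open>m / L\<close>
  adds up over the windows to the time spent in their union. The factor \<open>M\<close> counts
  the positions \<open>x\<close> in a window.
\<close>

lemma sum_windows_clip_step_le:
  assumes I: "strict_mono I" and "0 < L" "0 < M" "1 < \<rho>"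
  shows "(\<Sum>x<n * M. min 1 (clip_step I (real (x div M * M)) (real (x div M * M) + real M) j / L) powr \<rho>)
    \<le> real M / L * (clip_step I 0 (real (n * M)) j * min 1 ((real (I (Suc j)) - real (I j)) / L) powr (\<rho> - 1))"
proof -
  let ?st = "\<lambda>k. clip_step I (real (k * M)) (real (k * M) + real M) j"
  let ?m = "min 1 ((real (I (Suc j)) - real (I j)) / L) powr (\<rho> - 1)"
  have le: "min 1 (?st k / L) powr \<rho> \<le> ?st k / L * ?m" for k
  proof -
    have nn: "0 \<le> ?st k" by (rule clip_step_nonneg[OF I]) simp
    have "?st k \<le> real (I (Suc j)) - real (I j)" by (rule clip_step_le[OF I]) simp
    then have "min 1 (?st k / L) \<le> min 1 ((real (I (Suc j)) - real (I j)) / L)"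
      using assms(2) by (intro min.mono divide_right_mono) auto
    then have "min 1 (?st k / L) powr (\<rho> - 1) \<le> ?m"
      using nn assms(2,4) by (intro powr_mono2) auto
    moreover have "min 1 (?st k / L) powr \<rho> = min 1 (?st k / L) * min 1 (?st k / L) powr (\<rho> - 1)"
      using nn assms(2) by (simp add: powr_mult_base)
    moreover have "min 1 (?st k / L) * min 1 (?st k / L) powr (\<rho> - 1) \<le> ?st k / L * ?m"
      using nn assms(2) calculation(1) by (intro mult_mono) auto
    ultimately show ?thesis by simp
  qed
  have "(\<Sum>x<n * M. min 1 (?st (x div M) / L) powr \<rho>) = real M * (\<Sum>k<n. min 1 (?st k / L) powr \<rho>)"
    by (rule sum_div_windows[OF assms(3)])
  also have "\<dots> \<le> real M * (\<Sum>k<n. ?st k / L * ?m)"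
    by (intro mult_left_mono sum_mono le) simp
  also have "(\<Sum>k<n. ?st k / L * ?m) = (\<Sum>k<n. ?st k) / L * ?m"
    by (simp only: sum_divide_distrib sum_distrib_right)
  finally show ?thesis unfolding sum_clip_step_windows by simp
qed

text \<open>
  If \<open>s\<^sub>0\<close> is the first scale with \<open>l < J\<^bsup>s\<^sub>0 + 1\<^esup>\<close>, the terms are at most \<open>1\<close> at \<open>s = s\<^sub>0\<close> and at most
  \<open>J\<^bsup>-i\<beta>\<^esup>\<close> at \<open>s = s\<^sub>0 + 1 + i\<close>; they are dominated by a geometric series that does not depend on \<open>J\<close>,
  \<open>l\<close> or the number of scales.
\<close>

lemma sum_scales_le:
  fixes J :: nat and l \<beta> :: real
  assumes "2 \<le> J" "0 \<le> l" "0 < \<beta>"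
  shows "(\<Sum>s\<in>{s\<in>{..<S}. l < real J ^ Suc s}. min 1 (l / real J ^ s) powr \<beta>)
    \<le> 2 powr \<beta> / (1 - (1 / 2) powr \<beta>)"
proof -
  define \<theta> :: real where "\<theta> = (1 / 2) powr \<beta>"
  have \<theta>: "0 < \<theta>" "\<theta> < 1"
    using assms(3) powr_less_mono2[of \<beta> "1/2" "1::real"] by (auto simp: \<theta>_def)
  define A where "A = {s\<in>{..<S}. l < real J ^ Suc s}"
  define s0 where "s0 = (LEAST s. l < real J ^ Suc s)"
  have le: "min 1 (l / real J ^ s) powr \<beta> \<le> 2 powr \<beta> * \<theta> ^ (s - s0)" if "s \<in> A" for s
  proof -
    have "l < real J ^ Suc s" using that by (simp add: A_def)
    then have s0: "s0 \<le> s" "l < real J ^ Suc s0"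
      unfolding s0_def by (rule Least_le, rule LeastI)
    have "min 1 (l / real J ^ s) \<le> 2 * (1 / 2) ^ (s - s0)"
    proof (cases "s = s0")
      case False
      then obtain i where i: "s = Suc s0 + i" using s0(1) le_Suc_ex[of "Suc s0" s] by auto
      have "l / real J ^ s \<le> real J ^ Suc s0 / real J ^ s"
        using s0(2) by (intro divide_right_mono) auto
      also have "\<dots> = 1 / real J ^ i"
        using assms(1) unfolding i power_add by simp
      also have "\<dots> \<le> 1 / 2 ^ i"
        using assms(1) by (intro divide_left_mono power_mono) auto
      finally show ?thesis by (simp add: i power_one_over)
    qed simp
    then have "min 1 (l / real J ^ s) powr \<beta> \<le> (2 * (1 / 2) ^ (s - s0)) powr \<beta>"
      using assms by (intro powr_mono2) auto
    also have "\<dots> = 2 powr \<beta> * \<theta> ^ (s - s0)"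
      by (simp add: \<theta>_def powr_mult powr_power powr_powr mult.commute flip: powr_realpow)
    finally show ?thesis .
  qed
  have "A \<subseteq> {s0..<S + s0}"
    unfolding A_def s0_def by (auto intro!: Least_le)
  then have "(\<Sum>s\<in>A. min 1 (l / real J ^ s) powr \<beta>) \<le> (\<Sum>s\<in>{s0..<S + s0}. 2 powr \<beta> * \<theta> ^ (s - s0))"
    using \<theta> by (intro order_trans[OF sum_mono[OF le] sum_mono2]) auto
  also have "\<dots> = (\<Sum>i<S. 2 powr \<beta> * \<theta> ^ i)"
    using sum.shift_bounds_nat_ivl[of "\<lambda>s. 2 powr \<beta> * \<theta> ^ (s - s0)" 0 s0 S]
    by (simp add: atLeast0LessThan)
  also have "\<dots> = 2 powr \<beta> * ((1 - \<theta> ^ S) / (1 - \<theta>))"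
    using \<theta> by (simp add: sum_gp_strict flip: sum_distrib_left)
  also have "\<dots> \<le> 2 powr \<beta> * (1 / (1 - \<theta>))"
    using \<theta> by (intro mult_left_mono divide_right_mono) auto
  finally show ?thesis by (simp add: A_def \<theta>_def)
qed

definition window_start :: "nat \<Rightarrow> nat \<Rightarrow> nat" where
  "window_start M x = x div M * M"

lemma window_end_le:
  assumes "x < n * M"
  shows "window_start M x + M \<le> n * M"
proof -
  have "x div M < n" using assms by (simp add: less_mult_imp_div_less)
  then have "Suc (x div M) * M \<le> n * M" by (intro mult_le_mono1) simp
  then show ?thesis by (simp add: window_start_def)
qed

definition window_step :: "(nat \<Rightarrow> nat) \<Rightarrow> nat \<Rightarrow> nat \<Rightarrow> nat \<Rightarrow> real" where
  "window_step I M x = clip_step I (real (window_start M x)) (real (window_start M x) + real M)"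

text \<open>
  The bound for the \<open>\<rho>\<close>-th power of the oscillation of the wave with index \<open>(s, x)\<close>, restricted to
  the intervals shorter than its window.
\<close>

definition short_sum :: "real \<Rightarrow> (nat \<Rightarrow> nat) \<Rightarrow> nat \<Rightarrow> nat \<Rightarrow> nat \<Rightarrow> nat \<Rightarrow> real" where
  "short_sum \<rho> I J N s x = (\<Sum>j\<in>{j\<in>{..<N}. real (I (Suc j)) - real (I j) < real J ^ Suc s}.
     min 1 (window_step I (J ^ Suc s) x j / real J ^ s) powr \<rho>)"

text \<open>
  The heart of the argument: the right-hand side does not grow with the number \<open>S\<close> of scales,
  except through \<open>J ^ S\<close>, the number of positions. After exchanging the sums, each interval meets
  the geometric series of \<open>sum_scales_le\<close>, and the times spent in \<open>[0, J\<^sup>S]\<close> add up to at most \<open>J\<^sup>S\<close>.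
\<close>

lemma sum_short_sum_le:
  assumes I: "strict_mono I" and J: "2 \<le> J" and "1 < \<rho>"
  shows "(\<Sum>s<S. \<Sum>x<J ^ S. short_sum \<rho> I J (J ^ S) s x)
    \<le> real J * (2 powr (\<rho> - 1) / (1 - (1 / 2) powr (\<rho> - 1))) * real (J ^ S)"
proof -
  define N where "N = J ^ S"
  define K where "K = 2 powr (\<rho> - 1) / (1 - (1 / 2) powr (\<rho> - 1))"
  define l where "l j = real (I (Suc j)) - real (I j)" for j
  have l: "0 \<le> l j" for j using I by (simp add: l_def strict_mono_less_eq)
  \<comment> \<open>\<open>N\<close> is a multiple of every window length, so the windows of each scale tile \<open>[0, N)\<close>.\<close>
  have "(\<Sum>s<S. \<Sum>x<N. short_sum \<rho> I J N s x)
      \<le> (\<Sum>s<S. \<Sum>j\<in>{j\<in>{..<N}. l j < real J ^ Suc s}.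
            real J * (clip_step I 0 (real N) j * min 1 (l j / real J ^ s) powr (\<rho> - 1)))"
  proof (rule sum_mono)
    fix s assume "s \<in> {..<S}"
    then have "S = (S - Suc s) + Suc s" by simp
    then have N: "N = J ^ (S - Suc s) * J ^ Suc s" unfolding N_def by (metis power_add)
    have "real (J ^ Suc s) / real J ^ s = real J" using J by simp
    then have "(\<Sum>x<N. min 1 (window_step I (J ^ Suc s) x j / real J ^ s) powr \<rho>)
        \<le> real J * (clip_step I 0 (real N) j * min 1 (l j / real J ^ s) powr (\<rho> - 1))" for j
      using sum_windows_clip_step_le[OF I, where L = "real J ^ s" and M = "J ^ Suc s" and \<rho> = \<rho>
          and n = "J ^ (S - Suc s)" and j = j] J assms(3)
      unfolding window_step_def window_start_def l_def N[symmetric] by (simp del: power_Suc)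
    then show "(\<Sum>x<N. short_sum \<rho> I J N s x) \<le> (\<Sum>j\<in>{j\<in>{..<N}. l j < real J ^ Suc s}.
            real J * (clip_step I 0 (real N) j * min 1 (l j / real J ^ s) powr (\<rho> - 1)))"
      unfolding short_sum_def l_def[symmetric]
      by (subst sum.swap) (rule sum_mono)
  qed
  also have "\<dots> = (\<Sum>j<N. \<Sum>s\<in>{s\<in>{..<S}. l j < real J ^ Suc s}.
            real J * (clip_step I 0 (real N) j * min 1 (l j / real J ^ s) powr (\<rho> - 1)))"
    by (rule sum.swap_restrict) auto
  also have "\<dots> = (\<Sum>j<N. real J * (clip_step I 0 (real N) j *
      (\<Sum>s\<in>{s\<in>{..<S}. l j < real J ^ Suc s}. min 1 (l j / real J ^ s) powr (\<rho> - 1))))"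
    by (simp only: sum_distrib_left)
  also have "\<dots> \<le> (\<Sum>j<N. real J * (clip_step I 0 (real N) j * K))"
    unfolding K_def using assms(3)
    by (intro sum_mono mult_left_mono sum_scales_le J l clip_step_nonneg I) auto
  also have "\<dots> = real J * K * (\<Sum>j<N. clip_step I 0 (real N) j)"
    by (simp add: sum_distrib_left mult_ac)
  also have "\<dots> \<le> real J * K * real N"
  proof -
    have "(1 / 2 :: real) powr (\<rho> - 1) \<le> 1" using assms(3) by (intro powr_le1) auto
    then have "0 \<le> K" by (simp add: K_def)
    then show ?thesis using sum_clip_step_le[of 0 "real N" I N] by (intro mult_left_mono) auto
  qed
  finally show ?thesis by (simp add: N_def K_def)
qed

lemma short_sum_nonneg: "0 \<le> short_sum \<rho> I J N s x"
  unfolding short_sum_def by (intro sum_nonneg) simp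

text \<open>
  A pointwise bound, which turns the bound on the average into one for the averages of higher
  powers: since \<open>min(1, y)\<^sup>\<rho> \<le> y\<close>, the sum is at most the window length \<open>J\<^sup>s\<^sup>+\<^sup>1\<close> divided by \<open>J\<^sup>s\<close>.
\<close>

lemma short_sum_le:
  assumes I: "strict_mono I" and J: "0 < J" and "1 < \<rho>"
  shows "short_sum \<rho> I J N s x \<le> real J"
proof -
  let ?w = "window_step I (J ^ Suc s) x"
  have nn: "0 \<le> ?w j" for j unfolding window_step_def by (rule clip_step_nonneg[OF I]) simp
  have "short_sum \<rho> I J N s x \<le> (\<Sum>j<N. min 1 (?w j / real J ^ s) powr \<rho>)"
    unfolding short_sum_def by (rule sum_mono2) auto
  also have "\<dots> \<le> (\<Sum>j<N. ?w j / real J ^ s)"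
  proof (rule sum_mono)
    fix j
    have "min 1 (?w j / real J ^ s) powr \<rho> \<le> min 1 (?w j / real J ^ s) powr 1"
      using nn assms(3) by (intro powr_mono') auto
    also have "\<dots> \<le> ?w j / real J ^ s" using nn by simp
    finally show "min 1 (?w j / real J ^ s) powr \<rho> \<le> ?w j / real J ^ s" .
  qed
  also have "\<dots> = (\<Sum>j<N. ?w j) / real J ^ s" by (simp add: sum_divide_distrib)
  also have "\<dots> \<le> real (J ^ Suc s) / real J ^ s"
    unfolding window_step_def by (intro divide_right_mono order_trans[OF sum_clip_step_le]) auto
  finally show ?thesis using J by simp
qed

lemma sum_steps_le_short_sum:
  assumes I: "strict_mono I" and J: "0 < J" and "1 < \<rho>"
  shows "(\<Sum>j<N. min 1 (window_step I (J ^ Suc s) x j / real J ^ s) powr \<rho>) \<le> 2 + short_sum \<rho> I J N s x"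
proof -
  let ?f = "\<lambda>j. min 1 (window_step I (J ^ Suc s) x j / real J ^ s) powr \<rho>"
  let ?P = "\<lambda>j. real (I (Suc j)) - real (I j) < real J ^ Suc s"
  have "(\<Sum>j<N. ?f j) = (\<Sum>j\<in>{j\<in>{..<N}. \<not> ?P j}. ?f j) + (\<Sum>j\<in>{j\<in>{..<N}. ?P j}. ?f j)"
    by (subst sum.union_disjoint[symmetric]) (auto intro!: sum.cong)
  also have "(\<Sum>j\<in>{j\<in>{..<N}. \<not> ?P j}. ?f j) \<le> 2"
    using long_steps_le[OF I, of "real J ^ s" "real (window_start (J ^ Suc s) x)"
        "real (window_start (J ^ Suc s) x) + real (J ^ Suc s)" \<rho> N] J assms(3)
    by (simp add: window_step_def not_less)
  finally show ?thesis by (simp add: short_sum_def)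
qed

text \<open>
  Linearises the power \<open>q\<close> of the oscillation in the averaged quantity \<open>c\<close>. The factor \<open>B powr q\<close> stands
  only next to \<open>c\<close>, whose average can be made as small as desired, so it does not affect the
  final constant.
\<close>

lemma powr_two_plus_le:
  fixes c B q :: real
  assumes "0 \<le> c" "c \<le> B" "0 < q"
  shows "(2 + c) powr q \<le> 3 powr q * (1 + B powr q * c)"
proof (cases "c \<le> 1")
  case True
  have "(2 + c) powr q \<le> 3 powr q" using True assms by (intro powr_mono2) auto
  also have "\<dots> \<le> 3 powr q * (1 + B powr q * c)" using assms by simp
  finally show ?thesis .
next
  case False
  have "(2 + c) powr q \<le> (3 * B) powr q" using False assms by (intro powr_mono2) auto
  also have "\<dots> = 3 powr q * (B powr q * 1)" using assms by (simp add: powr_mult)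
  also have "\<dots> \<le> 3 powr q * (1 + B powr q * c)"
    using False by (intro mult_left_mono add_increasing) auto
  finally show ?thesis .
qed

section \<open>The family of waves\<close>

text \<open>
  The constant \<open>2 * 3 powr (p / \<rho>)\<close> does not involve \<open>J\<close>: with enough scales, the oscillation of an average
  member is essentially that caused by the at most two long intervals.
\<close>

lemma ex_many_jumps_small_oscillation:
  fixes p \<rho> :: real and J :: nat
  assumes "1 \<le> p" "1 < \<rho>" and J: "2 \<le> J"
  obtains f :: "int \<Rightarrow> nat \<Rightarrow> real" and A :: "int set"
  where "finite A" "A \<noteq> {}"
    and "\<And>x. x \<in> A \<Longrightarrow> \<exists>t. strict_mono_on {..J} t \<and> (\<forall>j<J. 2 / pi \<le> norm (f x (t (Suc j)) - f x (t j)))"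
    and "\<And>I. I \<in> seqs_inf \<Longrightarrow>
      lp_norm p (\<lambda>x. oscillation \<rho> I (f x)) \<le> ennreal ((2 * 3 powr (p / \<rho>) * real (card A)) powr (1 / p))"
proof -
  define q where "q = p / \<rho>"
  have q: "0 < q" using assms by (simp add: q_def)
  define K where "K = 2 powr (\<rho> - 1) / (1 - (1 / 2) powr (\<rho> - 1))"
  \<comment> \<open>Enough scales to make the average of \<open>J powr q * short_sum\<close> at most \<open>1\<close>.\<close>
  obtain S :: nat where S: "real J powr q * real J * K \<le> real S" "0 < S"
    by (metis real_arch_simple order_trans of_nat_le_iff le_Suc_eq order_refl zero_less_Suc)
  define N where "N = J ^ S"
  define E where "E = {..<S} \<times> {..<N}"
  define e where "e = (\<lambda>y. int (prod_encode y))"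
  have inj: "inj e" by (auto simp: e_def inj_def)
  define A where "A = e ` E"
  define w where "w = (\<lambda>(s, x). let a = window_start (J ^ Suc s) x in wave (J ^ s) a (real a + real (J ^ Suc s)))"
  define f where "f = (\<lambda>i. if i \<in> A then w (inv e i) else (\<lambda>_. 0))"
  have fe: "f (e y) = w y" if "y \<in> E" for y
    using that inj by (simp add: f_def A_def)
  have cardA: "card A = S * N"
    unfolding A_def by (simp add: card_image[OF inj_on_subset[OF inj subset_UNIV]] E_def)
  show thesis
  proof
    show "finite A" by (simp add: A_def E_def)
    show "A \<noteq> {}" using S J by (auto simp: A_def E_def N_def lessThan_empty_iff)
  next
    fix i assume "i \<in> A"
    then obtain s x where sx: "(s, x) \<in> E" "i = e (s, x)" by (auto simp: A_def)
    let ?a = "window_start (J ^ Suc s) x"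
    have "f i = wave (real (J ^ s)) (real ?a) (real (?a + J * J ^ s))"
      using fe[OF sx(1)] sx(2) by (simp add: w_def Let_def)
    then show "\<exists>t. strict_mono_on {..J} t \<and> (\<forall>j<J. 2 / pi \<le> norm (f i (t (Suc j)) - f i (t j)))"
      using wave_jumps[where L = "J ^ s" and J = J and a = ?a] J
      by (intro exI[of _ "\<lambda>i. ?a + i * J ^ s"]) auto
  next
    fix I assume "I \<in> seqs_inf"
    then have I: "strict_mono I" by (simp add: seqs_inf_def)
    define c where "c = (\<lambda>(s, x). \<Sum>j<N. min 1 (window_step I (J ^ Suc s) x j / real J ^ s) powr \<rho>)"
    have c0: "0 \<le> c y" for y by (auto simp: c_def split: prod.split intro!: sum_nonneg)
    have osc: "oscillation \<rho> I (w y) \<le> ennreal (c y powr (1 / \<rho>))" if yE: "y \<in> E" for y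
    proof -
      obtain s x where y: "y = (s, x)" "s < S" "x < N" using yE by (auto simp: E_def)
      have "S = (S - Suc s) + Suc s" using y by simp
      then have N: "N = J ^ (S - Suc s) * J ^ Suc s" unfolding N_def by (metis power_add)
      then have "window_start (J ^ Suc s) x + J ^ Suc s \<le> N" using window_end_le y(3) by metis
      then have "real (window_start (J ^ Suc s) x) + real (J ^ Suc s) \<le> real N" by linarith
      then show ?thesis
        using oscillation_wave_le[OF I, of "real (J ^ s)" "real (window_start (J ^ Suc s) x)"
          "real (window_start (J ^ Suc s) x) + real (J ^ Suc s)" N \<rho>] J assms(2)
        by (simp add: y(1) w_def c_def Let_def window_step_def)
    qed
    have "lp_norm p (\<lambda>i. oscillation \<rho> I (f i))
        \<le> ennreal ((\<Sum>i\<in>A. (c (inv e i) powr (1 / \<rho>)) powr p) powr (1 / p))"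
    proof (rule lp_norm_le)
      show "finite A" by (simp add: A_def E_def)
      show "oscillation \<rho> I (f i) = 0" if "i \<notin> A" for i
        using that by (simp add: f_def oscillation_const)
      show "oscillation \<rho> I (f i) \<le> ennreal (c (inv e i) powr (1 / \<rho>))" if "i \<in> A" for i
        using that osc fe inj by (auto simp: A_def)
    qed (use assms in auto)
    also have "\<dots> \<le> ennreal ((2 * 3 powr q * real (card A)) powr (1 / p))"
    proof -
      have "(\<Sum>i\<in>A. (c (inv e i) powr (1 / \<rho>)) powr p) = (\<Sum>y\<in>E. c y powr q)"
        unfolding A_def by (subst sum.reindex) (use inj in \<open>auto simp: inj_on_def powr_powr q_def\<close>)
      also have "\<dots> = (\<Sum>s<S. \<Sum>x<N. c (s, x) powr q)"
        unfolding E_def by (simp add: sum.cartesian_product)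
      also have "\<dots> \<le> (\<Sum>s<S. \<Sum>x<N. 3 powr q * (1 + real J powr q * short_sum \<rho> I J N s x))"
      proof (intro sum_mono)
        fix s x
        have "c (s, x) powr q \<le> (2 + short_sum \<rho> I J N s x) powr q"
          using sum_steps_le_short_sum[OF I, of J \<rho> s x N] c0[of "(s, x)"] J assms(2) q
          by (intro powr_mono2) (auto simp: c_def)
        also have "\<dots> \<le> 3 powr q * (1 + real J powr q * short_sum \<rho> I J N s x)"
          using J assms(2) q by (intro powr_two_plus_le short_sum_nonneg short_sum_le I) auto
        finally show "c (s, x) powr q \<le> 3 powr q * (1 + real J powr q * short_sum \<rho> I J N s x)" .
      qed
      also have "\<dots> = 3 powr q * (real (S * N) + real J powr q * (\<Sum>s<S. \<Sum>x<N. short_sum \<rho> I J N s x))"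
        by (simp add: sum.distrib flip: sum_distrib_left)
      also have "\<dots> \<le> 3 powr q * (real (S * N) + real J powr q * (real J * K * real N))"
        using sum_short_sum_le[OF I J assms(2), of S]
        by (intro mult_left_mono add_left_mono) (auto simp: N_def K_def)
      also have "real J powr q * (real J * K * real N) \<le> real S * real N"
        using mult_right_mono[OF S(1), of "real N"] by (simp add: mult_ac)
      finally have "(\<Sum>i\<in>A. (c (inv e i) powr (1 / \<rho>)) powr p) \<le> 2 * 3 powr q * real (card A)"
        by (simp add: cardA algebra_simps)
      then show ?thesis using assms by (intro ennreal_leI powr_mono2) (auto intro!: sum_nonneg)
    qed
    finally show "lp_norm p (\<lambda>x. oscillation \<rho> I (f x))
        \<le> ennreal ((2 * 3 powr (p / \<rho>) * real (card A)) powr (1 / p))"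
      by (simp add: q_def)
  qed
qed

text \<open>
  Common part of both claims: the functional \<open>\<Phi>\<close>, which stands for the left-hand side, enters only
  through a lower bound on functions with \<open>J\<close> jumps on a finite set, and this bound grows with \<open>J\<close>.
\<close>

lemma no_oscillation_bound:
  fixes \<Phi> :: "(int \<Rightarrow> nat \<Rightarrow> real) \<Rightarrow> ennreal" and p \<rho> r :: real
  assumes "1 \<le> p" "1 < \<rho>" "0 < r"
    and lower: "\<And>f A J. finite A \<Longrightarrow> 1 \<le> J \<Longrightarrow>
      (\<And>x. x \<in> A \<Longrightarrow> \<exists>t. strict_mono_on {..J} t \<and> (\<forall>j<J. 2 / pi \<le> norm (f x (t (Suc j)) - f x (t j)))) \<Longrightarrow>
      ennreal (2 / pi * real J powr (1 / r) / 2 * real (card A) powr (1 / p)) \<le> \<Phi> f"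
  shows "\<not> (\<exists>C::real. 0 \<le> C \<and> (\<forall>f.
    \<Phi> f \<le> ennreal C * (SUP I\<in>seqs_inf. lp_norm p (\<lambda>x. oscillation \<rho> I (f x)))))"
proof
  assume "\<exists>C::real. 0 \<le> C \<and> (\<forall>f.
    \<Phi> f \<le> ennreal C * (SUP I\<in>seqs_inf. lp_norm p (\<lambda>x. oscillation \<rho> I (f x))))"
  then obtain C :: real where C: "0 \<le> C"
    and bound: "\<And>f. \<Phi> f \<le> ennreal C * (SUP I\<in>seqs_inf. lp_norm p (\<lambda>x. oscillation \<rho> I (f x)))"
    by blast
  define D where "D = C * (2 * 3 powr (p / \<rho>)) powr (1 / p)"
  have D: "0 \<le> D" using C by (simp add: D_def)
  \<comment> \<open>This choice gives \<open>J powr (1 / r) > pi * D\<close>, while the assumed estimate gives the opposite.\<close>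
  obtain n :: nat where n: "(pi * D) powr r < real n" using reals_Archimedean2 by blast
  define J where "J = n + 2"
  obtain f :: "int \<Rightarrow> nat \<Rightarrow> real" and A where A: "finite A" "A \<noteq> {}"
    and jumps: "\<And>x. x \<in> A \<Longrightarrow> \<exists>t. strict_mono_on {..J} t \<and> (\<forall>j<J. 2 / pi \<le> norm (f x (t (Suc j)) - f x (t j)))"
    and osc: "\<And>I. I \<in> seqs_inf \<Longrightarrow>
      lp_norm p (\<lambda>x. oscillation \<rho> I (f x)) \<le> ennreal ((2 * 3 powr (p / \<rho>) * real (card A)) powr (1 / p))"
    using ex_many_jumps_small_oscillation[OF assms(1,2), of J] unfolding J_def by (metis le_add2)
  let ?c = "real (card A) powr (1 / p)"
  have "ennreal (2 / pi * real J powr (1 / r) / 2 * ?c) \<le> \<Phi> f"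
    by (rule lower) (use A jumps in \<open>auto simp: J_def\<close>)
  also have "\<dots> \<le> ennreal C * ennreal ((2 * 3 powr (p / \<rho>) * real (card A)) powr (1 / p))"
    by (intro order_trans[OF bound] mult_left_mono SUP_least osc) auto
  also have "\<dots> = ennreal (D * ?c)"
    using C by (simp add: D_def powr_mult mult.assoc flip: ennreal_mult)
  finally have "2 / pi * real J powr (1 / r) / 2 * ?c \<le> D * ?c"
    using D by (subst (asm) ennreal_le_iff) auto
  moreover have "0 < ?c" using A by (simp add: card_gt_0_iff)
  ultimately have "real J powr (1 / r) \<le> pi * D" by (simp add: field_simps)
  then have "(real J powr (1 / r)) powr r \<le> (pi * D) powr r"
    using assms(3) by (intro powr_mono2) auto
  then have "real J \<le> (pi * D) powr r" using assms(3) by (simp add: powr_powr)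
  then show False using n by (simp add: J_def)
qed

theorem theorem1p9:
  fixes p \<rho> r :: real
  assumes "1 \<le> p" and "1 < \<rho>" and "\<rho> \<le> r"
  shows
    "(\<not> (\<exists>C::real. 0 \<le> C \<and> (\<forall>f :: int \<Rightarrow> nat \<Rightarrow> real.
        (SUP l\<in>{0::real<..}. weak_lp_norm p (\<lambda>x. ennreal l * epowr (jump_count l (f x)) (1 / r)))
          \<le> ennreal C * (SUP I\<in>seqs_inf. lp_norm p (\<lambda>x. oscillation \<rho> I (f x))))))
     \<and>
     (\<not> (\<exists>C::real. 0 \<le> C \<and> (\<forall>f :: int \<Rightarrow> nat \<Rightarrow> real.
        weak_lp_norm p (\<lambda>x. variation r (f x))
          \<le> ennreal C * (SUP I\<in>seqs_inf. lp_norm p (\<lambda>x. oscillation \<rho> I (f x))))))"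
proof -
  have r: "0 < r" using assms by simp
  show ?thesis
  proof (intro conjI no_oscillation_bound assms r)
    fix f :: "int \<Rightarrow> nat \<Rightarrow> real" and A :: "int set" and J :: nat
    assume A: "finite A" "1 \<le> J" and jumps: "\<And>x. x \<in> A \<Longrightarrow> \<exists>t. strict_mono_on {..J} t \<and>
        (\<forall>j<J. 2 / pi \<le> norm (f x (t (Suc j)) - f x (t j)))"
    have "ennreal (2 / pi * real J powr (1 / r) / 2 * real (card A) powr (1 / p))
        \<le> weak_lp_norm p (\<lambda>x. ennreal (2 / pi) * epowr (jump_count (2 / pi) (f x)) (1 / r))"
    proof (rule weak_lp_norm_ge)
      show "ennreal (2 / pi * real J powr (1 / r))
          \<le> ennreal (2 / pi) * epowr (jump_count (2 / pi) (f x)) (1 / r)" if "x \<in> A" for x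
        using jumps[OF that] r jump_count_ge[of J _ "2 / pi" "f x" r] pi_gt_zero
        by (metis divide_pos_pos zero_less_numeral)
    qed (use A assms in auto)
    also have "\<dots> \<le> (SUP l\<in>{0::real<..}. weak_lp_norm p (\<lambda>x. ennreal l * epowr (jump_count l (f x)) (1 / r)))"
      by (rule SUP_upper) simp
    finally show "ennreal (2 / pi * real J powr (1 / r) / 2 * real (card A) powr (1 / p))
        \<le> (SUP l\<in>{0::real<..}. weak_lp_norm p (\<lambda>x. ennreal l * epowr (jump_count l (f x)) (1 / r)))" .
    show "ennreal (2 / pi * real J powr (1 / r) / 2 * real (card A) powr (1 / p))
        \<le> weak_lp_norm p (\<lambda>x. variation r (f x))"
    proof (rule weak_lp_norm_ge)
      show "ennreal (2 / pi * real J powr (1 / r)) \<le> variation r (f x)" if "x \<in> A" for x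
        using jumps[OF that] A(2) r variation_ge[of J _ "2 / pi" "f x" r] pi_gt_zero
        by (metis divide_pos_pos zero_less_numeral)
    qed (use A assms in auto)
  qed (rule r)+
qed

end
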